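(* Let $\mathbf{z}_1,\dots,\mathbf{z}_n$ be i.i.d. random variables in $\mathbb{R}^p$, let $\mathcal{H}$ be a Hilbert space, and let $\Psi:(\mathbb{R}^p)^u\to\mathcal{H}$ be a symmetric function with $\mathbb{E}[\Psi(\mathbf{z}_1,\dots,\mathbf{z}_u)]=0$. Let $$U_n=\frac{1}{\binom nu}\sum_{1\le i_1<\dots<i_u\le n}\Psi(\mathbf{z}_{i_1},\dots,\mathbf{z}_{i_u})\in\mathcal{H}.$$ Suppose that $\lVert\Psi(\mathbf{z}_1,\dots,\mathbf{z}_u)\rVert_{\mathcal{H}}\le C$ almost surely for some constant $C>0$. Then for all $c>0$ and $n\ge u$, $$\mathbb{P}\left(\lVert U_n\rVert_{\mathcal{H}}\ge c\right)\le2\exp\left(-\frac{\lfloor\frac nu\rfloor c^2}{4C^2}\right).$$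
   Context: $U_n$ is the vector-valued U-statistic of degree $u$ associated with $\Psi$; the sum is over the $\binom nu$ combinations of $u$ distinct indices from $\{1,\dots,n\}$. $\mathcal{H}$ may be infinite-dimensional. "Symmetric" means invariant under permutations of the $u$ arguments. *)

theory Defs
  imports "HOL-Probability.Probability" "HOL-Combinatorics.Permutations"
begin

(* The Bochner integral of HOL-Analysis is restricted to second countable codomains. The two
   notions below are its counterparts for arbitrary normed codomains, so that non-separable
   Hilbert spaces are covered. Strong measurability (pointwise limit of simple functions), unlike
   Borel measurability, is closed under sums in any normed space. *)

definition strongly_measurable :: "'a measure \<Rightarrow> ('a \<Rightarrow> 'b::real_normed_vector) \<Rightarrow> bool" where
  "strongly_measurable M f \<longleftrightarrow>
     (\<exists>s. (\<forall>i::nat. simple_function M (s i)) \<and> (\<forall>x\<in>space M. (\<lambda>i. s i x) \<longlonglongrightarrow> f x))"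

definition has_strong_integral ::
    "'a measure \<Rightarrow> ('a \<Rightarrow> 'b::real_normed_vector) \<Rightarrow> 'b \<Rightarrow> bool" where
  "has_strong_integral M f v \<longleftrightarrow> strongly_measurable M f \<and>
     (\<exists>s. (\<forall>i::nat. Bochner_Integration.simple_bochner_integrable M (s i)) \<and>
          (\<lambda>i. \<integral>\<^sup>+x. norm (f x - s i x) \<partial>M) \<longlonglongrightarrow> 0 \<and>
          (\<lambda>i. Bochner_Integration.simple_bochner_integral M (s i)) \<longlonglongrightarrow> v)"

lemma strongly_measurable_iff_borel_measurable:
  fixes f :: "'a \<Rightarrow> 'b::{real_normed_vector, second_countable_topology}"
  shows "strongly_measurable M f \<longleftrightarrow> f \<in> borel_measurable M"
proof
  assume "strongly_measurable M f"
  then obtain s where "\<And>i::nat. simple_function M (s i)"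
    and lim: "\<And>x. x \<in> space M \<Longrightarrow> (\<lambda>i. s i x) \<longlonglongrightarrow> f x"
    unfolding strongly_measurable_def by blast
  then have "\<And>i. s i \<in> borel_measurable M"
    by (simp add: borel_measurable_simple_function)
  then show "f \<in> borel_measurable M"
    using lim by (rule borel_measurable_LIMSEQ_metric)
next
  assume "f \<in> borel_measurable M"
  from borel_measurable_implies_sequence_metric[OF this, of 0]
  show "strongly_measurable M f"
    unfolding strongly_measurable_def by blast
qed

lemma has_strong_integral_iff_has_bochner_integral:
  fixes f :: "'a \<Rightarrow> 'b::{real_normed_vector, second_countable_topology}"
  shows "has_strong_integral M f v \<longleftrightarrow> has_bochner_integral M f v"
  unfolding has_strong_integral_def has_bochner_integral.simps
    strongly_measurable_iff_borel_measurable by auto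

(* A u-tuple is an extensional function on {1..u}, i.e. an element of {1..u} \<rightarrow>\<^sub>E UNIV. *)

definition symmetric_kernel :: "nat \<Rightarrow> ((nat \<Rightarrow> 'a) \<Rightarrow> 'h) \<Rightarrow> bool" where
  "symmetric_kernel u \<Psi> \<longleftrightarrow>
     (\<forall>\<pi>. \<pi> permutes {1..u} \<longrightarrow>
        (\<forall>x \<in> {1..u} \<rightarrow>\<^sub>E UNIV. \<Psi> (\<lambda>j\<in>{1..u}. x (\<pi> j)) = \<Psi> x))"

(* The sum ranges over the index tuples 1 \<le> i 1 < ... < i u \<le> n. *)

definition U_statistic ::
    "nat \<Rightarrow> nat \<Rightarrow> ((nat \<Rightarrow> 'a) \<Rightarrow> 'h::real_vector) \<Rightarrow> (nat \<Rightarrow> 'a) \<Rightarrow> 'h" where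
  "U_statistic n u \<Psi> x =
     (1 / real (n choose u)) *\<^sub>R
       (\<Sum>i | i \<in> {1..u} \<rightarrow>\<^sub>E {1..n} \<and> strict_mono_on {1..u} i.
          \<Psi> (\<lambda>j\<in>{1..u}. x (i j)))"

end

theory Submission
  imports Defs
begin

text \<open>
  The function \<open>cosh \<circ> sqrt\<close> is convex, so a vector \<open>v\<close> with \<open>norm v \<le> C\<close> satisfies
  \<open>cosh (norm (s + v)) \<le> cosh (norm s) * cosh C + K * inner s v\<close>, where \<open>K\<close> does not depend on
  \<open>v\<close>. For a centred random \<open>v\<close> the last term vanishes in expectation, and since
  \<open>cosh C \<le> exp (C\<^sup>2 / 2)\<close>, a sum \<open>S\<close> of \<open>k\<close> independent such vectors has
  \<open>E (cosh (norm S)) \<le> exp (k * C\<^sup>2 / 2)\<close>. Following Hoeffding, \<open>U\<^sub>n\<close> is the average, over all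
  permutations of the sample, of means of \<open>\<Psi>\<close> over \<open>k = n div u\<close> disjoint blocks; convexity of
  \<open>cosh\<close> carries the exponential bound over to \<open>U\<^sub>n\<close>, and Markov's inequality finishes. This even
  gives \<open>2 * C\<^sup>2\<close> in place of \<open>4 * C\<^sup>2\<close>.
\<close>

subsection \<open>Convexity of the hyperbolic cosine\<close>

text \<open>As a power series in the square of \<open>x\<close>, cosh has nonnegative coefficients,
  so inequalities in that square can be checked term by term.\<close>

lemma cosh_sums_even: "(\<lambda>m. (x\<^sup>2) ^ m / fact (2 * m)) sums cosh (x::real)"
proof -
  have "(\<lambda>m. (\<lambda>n. if even n then x ^ n /\<^sub>R fact n else 0) (2 * m)) sums cosh x"
  proof (subst sums_mono_reindex)
    show "strict_mono ((*) (2::nat))"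
      by (simp add: strict_mono_def)
    show "(if even n then x ^ n /\<^sub>R fact n else 0) = 0" if "n \<notin> range ((*) 2)" for n
      using that by (metis dvdE rangeI)
  qed (rule cosh_converges)
  moreover have "(\<lambda>n. if even n then x ^ n /\<^sub>R fact n else 0) (2 * m)
      = (x\<^sup>2) ^ m / fact (2 * m)" for m
    by (simp add: divide_inverse_commute flip: power_mult)
  ultimately show ?thesis
    by simp
qed

text \<open>Comparing the two series in the square of \<open>x\<close> termwise leaves 2^m * m!
  \<le> (2m)!, which follows by induction.\<close>

lemma cosh_le_exp_half_square: "cosh (x::real) \<le> exp (x\<^sup>2 / 2)"
proof (rule sums_le[OF _ cosh_sums_even])
  show "(\<lambda>m. (x\<^sup>2 / 2) ^ m / fact m) sums exp (x\<^sup>2 / 2)"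
    using exp_converges[of "x\<^sup>2 / 2"] by (simp only: real_scaleR_def divide_inverse mult.commute)
  fix m :: nat
  have "2 ^ m * fact m \<le> (fact (2 * m) :: real)"
  proof (induction m)
    case (Suc m)
    have "2 ^ Suc m * fact (Suc m) = 2 * real (Suc m) * (2 ^ m * fact m)"
      unfolding fact_Suc power_Suc by (simp only: mult_ac)
    also have "\<dots> \<le> 2 * real (Suc m) * fact (2 * m)"
      by (rule mult_left_mono[OF Suc]) simp
    also have "\<dots> \<le> 2 * real (Suc m) * (real (Suc (2 * m)) * fact (2 * m))"
      by (rule mult_left_mono) (auto simp del: of_nat_Suc)
    also have "\<dots> = fact (Suc (Suc (2 * m)))"
      unfolding fact_Suc by simp
    finally show ?case
      by simp
  qed simp
  then show "(x\<^sup>2) ^ m / fact (2 * m) \<le> (x\<^sup>2 / 2) ^ m / fact m"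
    by (simp add: power_divide frac_le)
qed

lemma convex_on_power_atLeast_0: "convex_on {0::real..} (\<lambda>x. x ^ n)"
  by (cases "even n")
    (auto intro: convex_power_odd convex_on_subset[OF convex_power_even])

text \<open>This is convexity of \<open>cosh \<circ> sqrt\<close> on the nonnegative reals, phrased
  through squares so that \<open>p\<close> and \<open>q\<close> may be negative. Each power is
  convex there, and the series adds these inequalities with nonnegative weights.\<close>

lemma cosh_le_if_square_between:
  fixes x p q t :: real
  assumes t: "0 \<le> t" "t \<le> 1" and x: "x\<^sup>2 = (1 - t) * p\<^sup>2 + t * q\<^sup>2"
  shows "cosh x \<le> (1 - t) * cosh p + t * cosh q"
proof (rule sums_le[OF _ cosh_sums_even])
  show "(\<lambda>m. (1 - t) * ((p\<^sup>2) ^ m / fact (2 * m)) + t * ((q\<^sup>2) ^ m / fact (2 * m)))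
      sums ((1 - t) * cosh p + t * cosh q)"
    by (intro sums_add sums_mult cosh_sums_even)
  fix m :: nat
  have "((1 - t) *\<^sub>R p\<^sup>2 + t *\<^sub>R q\<^sup>2) ^ m \<le> (1 - t) * (p\<^sup>2) ^ m + t * (q\<^sup>2) ^ m"
    using t by (intro convex_onD[OF convex_on_power_atLeast_0]) auto
  then have "(x\<^sup>2) ^ m \<le> (1 - t) * (p\<^sup>2) ^ m + t * (q\<^sup>2) ^ m"
    by (simp add: x)
  then show "(x\<^sup>2) ^ m / fact (2 * m)
      \<le> (1 - t) * ((p\<^sup>2) ^ m / fact (2 * m)) + t * ((q\<^sup>2) ^ m / fact (2 * m))"
    by (simp add: divide_right_mono flip: add_divide_distrib)
qed

lemma convex_on_cosh: "convex_on UNIV (cosh :: real \<Rightarrow> real)"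
proof (rule f''_ge0_imp_convex)
  show "(cosh has_real_derivative sinh x) (at x)" "(sinh has_real_derivative cosh x) (at x)"
    for x :: real
    by (auto intro!: derivative_eq_intros)
qed (auto intro: less_imp_le)

text \<open>With a = |s|, the square of |s + v| is at most a^2 + 2<s,v> + C^2, which lies between (a
  - C)^2 and (a + C)^2. Bounding \<open>cosh \<circ> sqrt\<close> by its chord over that interval
  gives an expression affine in \<open>inner s v\<close>, so its last term integrates to zero for
  centred \<open>v\<close>.\<close>

lemma cosh_norm_add_le:
  fixes s v :: "'a::real_inner"
  assumes v: "norm v \<le> C" and C: "0 < C"
  shows "cosh (norm (s + v))
    \<le> cosh (norm s) * cosh C + sinh (norm s) * sinh C / (norm s * C) * inner s v"
proof (cases "s = 0")
  \<comment> \<open>Here the quotient is 0 because division by zero yields 0, and only cosh |v|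
    \<le> cosh C remains.\<close>
  case True
  with v C show ?thesis by (simp add: cosh_real_nonneg_le_iff)
next
  case False
  define a where "a = norm s"
  define r where "r = inner s v / (a * C)"
  have a: "0 < a" using False by (simp add: a_def)
  have "\<bar>inner s v\<bar> \<le> a * norm v"
    unfolding a_def by (rule Cauchy_Schwarz_ineq2)
  also have "\<dots> \<le> a * C"
    using a v by simp
  finally have r: "-1 \<le> r" "r \<le> 1"
    using a C by (auto simp: r_def field_simps abs_le_iff)
  have inner: "inner s v = r * (a * C)"
    using a C by (simp add: r_def)
  \<comment> \<open>This weight places the bound a^2 + 2<s,v> + C^2 on the segment from (a - C)^2 to
    (a + C)^2. As 2t - 1 = r, the addition formulas below leave r as the coefficient of sinh a *
    sinh C.\<close>
  define t where "t = (1 + r) / 2"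
  define y where "y = (1 - t) * (a - C)\<^sup>2 + t * (a + C)\<^sup>2"
  have y: "y = a\<^sup>2 + 2 * inner s v + C\<^sup>2"
    unfolding y_def t_def inner by (simp add: field_simps power2_eq_square)
  have t: "0 \<le> t" "t \<le> 1" using r by (auto simp: t_def)
  have y0: "0 \<le> y" using t by (auto simp: y_def)
  have "(norm (s + v))\<^sup>2 = a\<^sup>2 + 2 * inner s v + (norm v)\<^sup>2"
    by (simp add: a_def power2_norm_eq_inner inner_add inner_commute)
  also have "\<dots> \<le> y"
    using v unfolding y by (simp add: power_mono)
  finally have "norm (s + v) \<le> sqrt y"
    by (rule real_le_rsqrt)
  then have "cosh (norm (s + v)) \<le> cosh (sqrt y)"
    using y0 by (simp add: cosh_real_nonneg_le_iff)
  also have "\<dots> \<le> (1 - t) * cosh (a - C) + t * cosh (a + C)"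
    using t y0 by (intro cosh_le_if_square_between) (auto simp: y_def)
  also have "\<dots> = cosh a * cosh C + r * (sinh a * sinh C)"
    by (simp add: cosh_add cosh_diff t_def field_simps)
  finally show ?thesis
    by (simp add: r_def a_def mult.commute)
qed

subsection \<open>Strongly measurable functions\<close>

lemma strongly_measurable_compose:
  assumes T: "T \<in> measurable M N" and f: "strongly_measurable N f"
  shows "strongly_measurable M (\<lambda>x. f (T x))"
proof -
  obtain s where s: "\<And>i::nat. simple_function N (s i)"
    and lim: "\<And>x. x \<in> space N \<Longrightarrow> (\<lambda>i. s i x) \<longlonglongrightarrow> f x"
    using f unfolding strongly_measurable_def by blast
  have "\<forall>i. simple_function M (\<lambda>x. s i (T x))"
    using simple_function_comp[OF T s] by blast
  moreover have "\<forall>x\<in>space M. (\<lambda>i. s i (T x)) \<longlonglongrightarrow> f (T x)"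
    using lim T by (auto dest: measurable_space)
  ultimately show ?thesis
    unfolding strongly_measurable_def by (intro exI[of _ "\<lambda>i x. s i (T x)"]) blast
qed

lemma strongly_measurable_continuous:
  assumes h: "continuous_on UNIV h" and f: "strongly_measurable M f"
  shows "strongly_measurable M (\<lambda>x. h (f x))"
proof -
  obtain s where s: "\<And>i::nat. simple_function M (s i)"
    and lim: "\<And>x. x \<in> space M \<Longrightarrow> (\<lambda>i. s i x) \<longlonglongrightarrow> f x"
    using f unfolding strongly_measurable_def by blast
  have "\<forall>i. simple_function M (\<lambda>x. h (s i x))"
    by (intro allI simple_function_compose1[where g=h] s)
  moreover have "\<forall>x\<in>space M. (\<lambda>i. h (s i x)) \<longlonglongrightarrow> h (f x)"
    using lim h by (auto intro: continuous_on_tendsto_compose[OF h])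
  ultimately show ?thesis
    unfolding strongly_measurable_def by (intro exI[of _ "\<lambda>i x. h (s i x)"]) blast
qed

lemma strongly_measurable_sum:
  fixes f :: "'i \<Rightarrow> 'a \<Rightarrow> 'b::real_normed_vector"
  assumes "finite J" and "\<And>j. j \<in> J \<Longrightarrow> strongly_measurable M (f j)"
  shows "strongly_measurable M (\<lambda>x. \<Sum>j\<in>J. f j x)"
  using assms
proof (induction J rule: finite_induct)
  case empty
  show ?case
    unfolding strongly_measurable_def by (intro exI[of _ "\<lambda>_ _. 0"]) auto
next
  case (insert j J)
  have f_j: "strongly_measurable M (f j)" and sum_J: "strongly_measurable M (\<lambda>x. \<Sum>j\<in>J. f j x)"
    using insert by simp_all
  obtain s where s: "\<And>i::nat. simple_function M (s i)"
    and lims: "\<And>x. x \<in> space M \<Longrightarrow> (\<lambda>i. s i x) \<longlonglongrightarrow> f j x"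
    using f_j unfolding strongly_measurable_def by blast
  obtain t where t: "\<And>i::nat. simple_function M (t i)"
    and limt: "\<And>x. x \<in> space M \<Longrightarrow> (\<lambda>i. t i x) \<longlonglongrightarrow> (\<Sum>j\<in>J. f j x)"
    using sum_J unfolding strongly_measurable_def by blast
  have "\<forall>i. simple_function M (\<lambda>x. s i x + t i x)"
    by (intro allI simple_function_compose2[where h="(+)"] s t)
  moreover have "\<forall>x\<in>space M. (\<lambda>i. s i x + t i x) \<longlonglongrightarrow> (\<Sum>j\<in>insert j J. f j x)"
    using lims limt insert.hyps by (auto intro!: tendsto_add)
  ultimately show ?case
    unfolding strongly_measurable_def by (intro exI[of _ "\<lambda>i x. s i x + t i x"]) blast
qed

text \<open>The bridge from a possibly non-separable space to real-valued integrands, where strong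
  and Borel measurability coincide.\<close>

lemma borel_measurable_strongly_measurable_continuous:
  fixes h :: "'b::real_normed_vector \<Rightarrow> real"
  assumes "continuous_on UNIV h" and "strongly_measurable M f"
  shows "(\<lambda>x. h (f x)) \<in> borel_measurable M"
  using strongly_measurable_continuous[OF assms]
  by (simp add: strongly_measurable_iff_borel_measurable)

text \<open>Pairing the simple approximants with \<open>w\<close> gives real ones, and
  Cauchy-Schwarz bounds their L1 error by |w| times the original error. The tail bound uses the
  vector mean only through these scalar means.\<close>

lemma has_strong_integral_inner:
  fixes f :: "'a \<Rightarrow> 'b::real_inner"
  assumes f: "has_strong_integral M f v"
  shows "has_bochner_integral M (\<lambda>x. inner w (f x)) (inner w v)"
proof -
  obtain s where s: "\<And>i::nat. Bochner_Integration.simple_bochner_integrable M (s i)"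
    and lim: "(\<lambda>i. \<integral>\<^sup>+x. norm (f x - s i x) \<partial>M) \<longlonglongrightarrow> 0"
    and lim': "(\<lambda>i. Bochner_Integration.simple_bochner_integral M (s i)) \<longlonglongrightarrow> v"
    using f unfolding has_strong_integral_def by blast
  have meas: "strongly_measurable M f"
    using f unfolding has_strong_integral_def by blast
  have simple: "simple_function M (s i)" for i
    using s[of i] by (auto elim: Bochner_Integration.simple_bochner_integrable.cases)
  have norm_meas: "(\<lambda>x. ennreal (norm (f x - s i x))) \<in> borel_measurable M" for i
  proof -
    have "strongly_measurable M (s i)"
      unfolding strongly_measurable_def using simple[of i] by (intro exI[of _ "\<lambda>_. s i"]) auto
    then have "strongly_measurable M (\<lambda>x. - s i x)"
      by (rule strongly_measurable_continuous[rotated]) (intro continuous_intros)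
    \<comment> \<open>The difference is encoded as a sum over the two booleans so that the lemma on
      finite sums applies.\<close>
    then have "strongly_measurable M (\<lambda>x. \<Sum>b\<in>UNIV. (if b then f else (\<lambda>x. - s i x)) x)"
      using meas by (intro strongly_measurable_sum) (simp_all split: if_split)
    then have "strongly_measurable M (\<lambda>x. f x - s i x)"
      by (simp add: UNIV_bool)
    then show ?thesis
      by (intro measurable_compose[OF _ measurable_ennreal]
          borel_measurable_strongly_measurable_continuous[of norm])
        (auto intro: continuous_intros)
  qed
  show ?thesis
  proof (rule has_bochner_integral.intros)
    show "(\<lambda>x. inner w (f x)) \<in> borel_measurable M"
      using meas by (rule borel_measurable_strongly_measurable_continuous[rotated])
        (intro continuous_intros)
    show "Bochner_Integration.simple_bochner_integrable M (\<lambda>x. inner w (s i x))" for i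
      \<comment> \<open>The second argument of the binary composition is a dummy.\<close>
      using Bochner_Integration.simple_bochner_integrable_compose2
        [where p="\<lambda>x y. inner w x", OF _ s s] by simp
    show "(\<lambda>i. Bochner_Integration.simple_bochner_integral M (\<lambda>x. inner w (s i x)))
        \<longlonglongrightarrow> inner w v"
      using s lim' by (auto intro!: tendsto_intros
          simp: Bochner_Integration.simple_bochner_integral_linear[OF bounded_linear.linear[OF bounded_linear_inner_right]])
    have le: "(\<integral>\<^sup>+x. norm (inner w (f x) - inner w (s i x)) \<partial>M)
        \<le> ennreal (norm w) * (\<integral>\<^sup>+x. norm (f x - s i x) \<partial>M)" for i
    proof -
      have "(\<integral>\<^sup>+x. norm (inner w (f x) - inner w (s i x)) \<partial>M)
          \<le> (\<integral>\<^sup>+x. ennreal (norm w) * ennreal (norm (f x - s i x)) \<partial>M)"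
        by (intro nn_integral_mono)
          (simp add: Cauchy_Schwarz_ineq2 flip: inner_diff_right ennreal_mult)
      also have "\<dots> = ennreal (norm w) * (\<integral>\<^sup>+x. norm (f x - s i x) \<partial>M)"
        by (rule nn_integral_cmult[OF norm_meas])
      finally show ?thesis .
    qed
    have "(\<lambda>i. ennreal (norm w) * (\<integral>\<^sup>+x. norm (f x - s i x) \<partial>M)) \<longlonglongrightarrow> ennreal (norm w) * 0"
      by (intro tendsto_mult_ennreal tendsto_const lim) auto
    then have upper: "(\<lambda>i. ennreal (norm w) * (\<integral>\<^sup>+x. norm (f x - s i x) \<partial>M)) \<longlonglongrightarrow> 0"
      by simp
    show "(\<lambda>i. \<integral>\<^sup>+x. norm (inner w (f x) - inner w (s i x)) \<partial>M) \<longlonglongrightarrow> 0"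
      by (rule tendsto_sandwich[OF always_eventually always_eventually tendsto_const upper])
        (intro allI zero_le, intro allI le)
  qed
qed

subsection \<open>Independent sums and blocks\<close>

text \<open>One step of the induction over independent summands: \<open>s\<close> is the sum of the
  others, held fixed. The linear term has mean zero, and cosh C is bounded by the Gaussian
  factor.\<close>

lemma nn_integral_cosh_norm_add_le:
  fixes g :: "'a \<Rightarrow> 'b::real_inner"
  assumes Q: "prob_space Q" and C: "0 < C"
    and bound: "AE y in Q. norm (g y) \<le> C"
    and mean: "\<And>w. has_bochner_integral Q (\<lambda>y. inner w (g y)) 0"
  shows "(\<integral>\<^sup>+y. cosh (norm (s + g y)) \<partial>Q) \<le> ennreal (cosh (norm s) * exp (C\<^sup>2 / 2))"
proof -
  interpret prob_space Q by fact
  define K where "K = sinh (norm s) * sinh C / (norm s * C)"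
  have le: "AE y in Q. cosh (norm (s + g y)) \<le> cosh (norm s) * cosh C + K * inner s (g y)"
    using bound unfolding K_def by eventually_elim (rule cosh_norm_add_le[OF _ C])
  have int: "integrable Q (\<lambda>y. cosh (norm s) * cosh C + K * inner s (g y))"
    using mean[of s] by (auto simp: has_bochner_integral_iff)
  have "(\<integral>\<^sup>+y. cosh (norm (s + g y)) \<partial>Q)
      \<le> (\<integral>\<^sup>+y. ennreal (cosh (norm s) * cosh C + K * inner s (g y)) \<partial>Q)"
    using le by (intro nn_integral_mono_AE) (auto intro: ennreal_leI)
  \<comment> \<open>Passing to the real integral requires an integrand that is nonnegative almost
    everywhere; it is, since it dominates a cosh.\<close>
  also have "\<dots> = ennreal (\<integral>y. cosh (norm s) * cosh C + K * inner s (g y) \<partial>Q)"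
    using le by (intro nn_integral_eq_integral[OF int])
      (auto elim!: eventually_mono intro: order_trans[OF cosh_real_nonneg])
  also have "(\<integral>y. cosh (norm s) * cosh C + K * inner s (g y) \<partial>Q) = cosh (norm s) * cosh C"
    using mean[of s] by (subst Bochner_Integration.integral_add)
      (auto simp: has_bochner_integral_iff prob_space)
  also have "\<dots> \<le> cosh (norm s) * exp (C\<^sup>2 / 2)"
    by (intro mult_left_mono cosh_le_exp_half_square) simp
  finally show ?thesis
    by (simp add: ennreal_leI)
qed

text \<open>By Fubini the new coordinate is integrated first with the others fixed, so each
  coordinate contributes one factor exp(C^2 / 2).\<close>

lemma nn_integral_cosh_norm_sum_le:
  fixes g :: "'a \<Rightarrow> 'b::real_inner" and J :: "'i set"
  assumes Q: "prob_space Q" and C: "0 < C" and g: "strongly_measurable Q g"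
    and bound: "AE y in Q. norm (g y) \<le> C"
    and mean: "\<And>w. has_bochner_integral Q (\<lambda>y. inner w (g y)) 0"
    and J: "finite J"
  shows "(\<integral>\<^sup>+x. cosh (norm (\<Sum>j\<in>J. g (x j))) \<partial>Pi\<^sub>M J (\<lambda>_. Q)) \<le> ennreal (exp (C\<^sup>2 / 2) ^ card J)"
proof -
  interpret prob_space Q by fact
  interpret product_prob_space "\<lambda>_. Q" UNIV ..
  show ?thesis
    using J
  proof (induction J rule: finite_induct)
    case empty
    show ?case
      by (simp add: PiM_empty nn_integral_count_space_finite)
  next
    case (insert i J)
    have meas: "(\<lambda>x. ennreal (cosh (norm (\<Sum>j\<in>I. g (x j))))) \<in> borel_measurable (Pi\<^sub>M I (\<lambda>_. Q))"
      if "finite I" for I :: "'i set"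
    proof -
      have "strongly_measurable (Pi\<^sub>M I (\<lambda>_. Q)) (\<lambda>x. \<Sum>j\<in>I. g (x j))"
        using that by (intro strongly_measurable_sum strongly_measurable_compose[OF _ g]) auto
      then show ?thesis
        by (intro measurable_compose[OF _ measurable_ennreal]
            borel_measurable_strongly_measurable_continuous[of "\<lambda>v. cosh (norm v)"])
          (auto intro!: continuous_intros)
    qed
    have "(\<integral>\<^sup>+x. cosh (norm (\<Sum>j\<in>insert i J. g (x j))) \<partial>Pi\<^sub>M (insert i J) (\<lambda>_. Q))
        = (\<integral>\<^sup>+x. \<integral>\<^sup>+y. cosh (norm (\<Sum>j\<in>insert i J. g ((x(i := y)) j))) \<partial>Q \<partial>Pi\<^sub>M J (\<lambda>_. Q))"
      using insert.hyps by (intro product_nn_integral_insert meas) auto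
    also have "\<dots> = (\<integral>\<^sup>+x. \<integral>\<^sup>+y. cosh (norm ((\<Sum>j\<in>J. g (x j)) + g y)) \<partial>Q \<partial>Pi\<^sub>M J (\<lambda>_. Q))"
    proof -
      have "(\<Sum>j\<in>insert i J. g ((x(i := y)) j)) = (\<Sum>j\<in>J. g (x j)) + g y" for x y
        using insert.hyps by (simp add: add.commute) (auto intro: sum.cong)
      then show ?thesis by simp
    qed
    also have "\<dots> \<le> (\<integral>\<^sup>+x. ennreal (cosh (norm (\<Sum>j\<in>J. g (x j)))) * ennreal (exp (C\<^sup>2 / 2))
        \<partial>Pi\<^sub>M J (\<lambda>_. Q))"
      using nn_integral_cosh_norm_add_le[OF Q C bound mean]
      by (intro nn_integral_mono) (simp flip: ennreal_mult)
    also have "\<dots> = (\<integral>\<^sup>+x. cosh (norm (\<Sum>j\<in>J. g (x j))) \<partial>Pi\<^sub>M J (\<lambda>_. Q)) * ennreal (exp (C\<^sup>2 / 2))"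
      using insert.hyps by (intro nn_integral_multc meas)
    also have "\<dots> \<le> ennreal (exp (C\<^sup>2 / 2) ^ card J) * ennreal (exp (C\<^sup>2 / 2))"
      by (intro mult_right_mono insert.IH) simp
    also have "\<dots> = ennreal (exp (C\<^sup>2 / 2) ^ card (insert i J))"
      using insert.hyps by (simp add: mult.commute flip: ennreal_mult)
    finally show ?case .
  qed
qed

lemma (in prob_space) indep_vars_reindex:
  assumes X: "indep_vars (\<lambda>_. N) X (\<tau> ` K)" and inj: "inj_on \<tau> K"
  shows "indep_vars (\<lambda>_. N) (\<lambda>k. X (\<tau> k)) K"
proof -
  define F where "F i = {X i -` A \<inter> space M | A. A \<in> sets N}" for i
  have "indep_sets F (\<tau> ` K)"
    using X by (simp add: indep_vars_def2 F_def[abs_def])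
  then have F: "\<And>k. k \<in> K \<Longrightarrow> F (\<tau> k) \<subseteq> events"
    and prod: "\<And>J A. J \<subseteq> \<tau> ` K \<Longrightarrow> J \<noteq> {} \<Longrightarrow> finite J \<Longrightarrow> A \<in> Pi J F \<Longrightarrow>
      prob (\<Inter>j\<in>J. A j) = (\<Prod>j\<in>J. prob (A j))"
    by (auto simp: indep_sets_def)
  have "indep_sets (\<lambda>k. F (\<tau> k)) K"
  proof (rule indep_setsI)
    fix A J assume J: "J \<noteq> {}" "J \<subseteq> K" "finite J" and A: "\<forall>j\<in>J. A j \<in> F (\<tau> j)"
    have inj_J: "inj_on \<tau> J"
      using inj J(2) by (rule inj_on_subset)
    \<comment> \<open>The events are relabelled along the inverse of \<open>\<tau>\<close> to match
      the original index set.\<close>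
    define B where "B = (\<lambda>i. A (the_inv_into J \<tau> i))"
    have B: "B (\<tau> j) = A j" if "j \<in> J" for j
      using the_inv_into_f_f[OF inj_J that] by (simp add: B_def)
    have "prob (\<Inter>i\<in>\<tau> ` J. B i) = (\<Prod>i\<in>\<tau> ` J. prob (B i))"
      using J A B by (intro prod) auto
    then show "prob (\<Inter>j\<in>J. A j) = (\<Prod>j\<in>J. prob (A j))"
      using B by (simp add: prod.reindex[OF inj_J])
  qed (rule F)
  then show ?thesis
    using X by (auto simp: indep_vars_def2 F_def)
qed

lemma (in prob_space) distr_iid_tuple:
  assumes "indep_vars (\<lambda>_. N) X I" and "\<And>i. i \<in> I \<Longrightarrow> distr M N (X i) = D"
    and "inj_on \<tau> K" "\<tau> ` K \<subseteq> I" "K \<noteq> {}"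
  shows "distr M (Pi\<^sub>M K (\<lambda>_. N)) (\<lambda>\<omega>. \<lambda>k\<in>K. X (\<tau> k) \<omega>) = Pi\<^sub>M K (\<lambda>_. D)"
proof -
  have "indep_vars (\<lambda>_. N) (\<lambda>k. X (\<tau> k)) K"
    using indep_vars_reindex[OF indep_vars_subset[OF assms(1,4)] assms(3)] .
  then have "distr M (Pi\<^sub>M K (\<lambda>_. N)) (\<lambda>\<omega>. \<lambda>k\<in>K. X (\<tau> k) \<omega>)
      = Pi\<^sub>M K (\<lambda>k. distr M N (X (\<tau> k)))"
    using indep_vars_iff_distr_eq_PiM'[of K "\<lambda>k. X (\<tau> k)" "\<lambda>_. N"] assms(5)
    by (simp add: indep_vars_def2)
  also have "\<dots> = Pi\<^sub>M K (\<lambda>_. D)"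
    using assms(2,4) by (intro PiM_cong) auto
  finally show ?thesis .
qed

text \<open>Injectivity on pairs says that the blocks are disjoint and repeat no index; hence they
  are independent, and each is an i.i.d. tuple.\<close>

lemma (in prob_space) distr_iid_blocks:
  assumes X: "indep_vars (\<lambda>_. N) X I" and D: "\<And>i. i \<in> I \<Longrightarrow> distr M N (X i) = D"
    and inj: "inj_on (\<lambda>(l, k). \<tau> l k) (L \<times> K)" and sub: "(\<lambda>(l, k). \<tau> l k) ` (L \<times> K) \<subseteq> I"
    and ne: "L \<noteq> {}" "K \<noteq> {}"
  shows "distr M (Pi\<^sub>M L (\<lambda>_. Pi\<^sub>M K (\<lambda>_. N))) (\<lambda>\<omega>. \<lambda>l\<in>L. \<lambda>k\<in>K. X (\<tau> l k) \<omega>)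
    = Pi\<^sub>M L (\<lambda>_. Pi\<^sub>M K (\<lambda>_. D))"
proof -
  define Y where "Y = (\<lambda>(l, k). X (\<tau> l k))"
  have Y: "indep_vars (\<lambda>_. N) Y (L \<times> K)"
    using indep_vars_reindex[OF indep_vars_subset[OF X sub] inj]
    by (simp add: Y_def case_prod_unfold)
  \<comment> \<open>The doubly indexed family is grouped into rows; afterwards the constant row
    index is dropped from the coordinates.\<close>
  have "indep_vars (\<lambda>l. Pi\<^sub>M ({l} \<times> K) (\<lambda>_. N)) (\<lambda>l \<omega>. \<lambda>i\<in>{l} \<times> K. Y i \<omega>) L"
    by (rule indep_vars_restrict[OF Y]) (auto simp: disjoint_family_on_def)
  then have "indep_vars (\<lambda>_. Pi\<^sub>M K (\<lambda>_. N)) (\<lambda>l \<omega>. \<lambda>k\<in>K. (\<lambda>i\<in>{l} \<times> K. Y i \<omega>) (l, k)) L"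
    by (rule indep_vars_compose2[where Y="\<lambda>l x. \<lambda>k\<in>K. x (l, k)"])
      (auto intro!: measurable_restrict measurable_component_singleton)
  also have "(\<lambda>l \<omega>. \<lambda>k\<in>K. (\<lambda>i\<in>{l} \<times> K. Y i \<omega>) (l, k)) = (\<lambda>l \<omega>. \<lambda>k\<in>K. X (\<tau> l k) \<omega>)"
    by (auto simp: Y_def fun_eq_iff)
  finally have blocks: "indep_vars (\<lambda>_. Pi\<^sub>M K (\<lambda>_. N)) (\<lambda>l \<omega>. \<lambda>k\<in>K. X (\<tau> l k) \<omega>) L" .
  then have "distr M (Pi\<^sub>M L (\<lambda>_. Pi\<^sub>M K (\<lambda>_. N))) (\<lambda>\<omega>. \<lambda>l\<in>L. \<lambda>k\<in>K. X (\<tau> l k) \<omega>)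
      = Pi\<^sub>M L (\<lambda>l. distr M (Pi\<^sub>M K (\<lambda>_. N)) (\<lambda>\<omega>. \<lambda>k\<in>K. X (\<tau> l k) \<omega>))"
    using indep_vars_iff_distr_eq_PiM'
      [of L "\<lambda>l \<omega>. \<lambda>k\<in>K. X (\<tau> l k) \<omega>" "\<lambda>_. Pi\<^sub>M K (\<lambda>_. N)"] ne
    by (simp add: indep_vars_def2)
  also have "\<dots> = Pi\<^sub>M L (\<lambda>_. Pi\<^sub>M K (\<lambda>_. D))"
  proof (intro PiM_cong refl distr_iid_tuple[OF X D] ne)
    fix l assume l: "l \<in> L"
    show "inj_on (\<tau> l) K"
      using l inj by (auto simp: inj_on_def)
    show "\<tau> l ` K \<subseteq> I"
      using l sub by auto
  qed
  finally show ?thesis .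
qed

subsection \<open>Averaging over permutations\<close>

text \<open>Listing the values of either function in order gives the sorted list of the common
  image.\<close>

lemma increasing_enumeration_unique:
  fixes f g :: "nat \<Rightarrow> nat"
  assumes f: "strict_mono_on {1..u} f" and g: "strict_mono_on {1..u} g"
    and eq: "f ` {1..u} = g ` {1..u}" and j: "j \<in> {1..u}"
  shows "f j = g j"
proof -
  have *: "sorted_list_of_set (h ` {1..u}) = map h [1..<Suc u]"
    if h: "strict_mono_on {1..u} h" for h :: "nat \<Rightarrow> nat"
  proof -
    have "sorted_wrt (\<lambda>i j. h i < h j) [1..<Suc u]"
      by (rule sorted_wrt_mono_rel[OF _ sorted_wrt_upt])
        (use h in \<open>auto simp: strict_mono_on_def\<close>)
    then have "sorted_wrt (<) (map h [1..<Suc u])"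
      by (simp add: sorted_wrt_map del: upt_Suc)
    moreover have "set (map h [1..<Suc u]) = h ` {1..u}"
      by auto
    ultimately show ?thesis
      by (metis sorted_list_of_set.idem_if_sorted_distinct strict_sorted_iff)
  qed
  have "map f [1..<Suc u] = map g [1..<Suc u]"
    using *[OF f] *[OF g] eq by simp
  then have "\<forall>j\<in>set [1..<Suc u]. f j = g j"
    by (simp only: map_eq_conv)
  then show ?thesis
    using j by (simp del: upt_Suc)
qed

text \<open>Turns the sum over increasing index tuples into a sum over u-element subsets, on which
  permutations of the sample act.\<close>

lemma bij_betw_increasing_subsets:
  "bij_betw (\<lambda>i. i ` {1..u})
     {i. i \<in> {1..u} \<rightarrow>\<^sub>E {1..n::nat} \<and> strict_mono_on {1..u::nat} i}
     {A. A \<subseteq> {1..n} \<and> card A = u}"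
proof (rule bij_betwI')
  fix i k
  assume "i \<in> {i. i \<in> {1..u} \<rightarrow>\<^sub>E {1..n} \<and> strict_mono_on {1..u} i}"
    and "k \<in> {i. i \<in> {1..u} \<rightarrow>\<^sub>E {1..n} \<and> strict_mono_on {1..u} i}"
  then show "(i ` {1..u} = k ` {1..u}) = (i = k)"
    using PiE_ext[of i "{1..u}" "\<lambda>_. {1..n}" k] increasing_enumeration_unique[of u i k] by blast
next
  fix i
  assume "i \<in> {i. i \<in> {1..u} \<rightarrow>\<^sub>E {1..n} \<and> strict_mono_on {1..u} i}"
  then show "i ` {1..u} \<in> {A. A \<subseteq> {1..n} \<and> card A = u}"
    by (auto simp: card_image[OF strict_mono_on_imp_inj_on])
next
  fix A
  assume "A \<in> {A. A \<subseteq> {1..n} \<and> card A = u}"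
  then have A: "A \<subseteq> {1..n}" "card A = u" and fin: "finite A"
    by (auto dest: finite_subset)
  obtain h where h: "bij_betw h {..<u} A" "strict_mono_on {..<u} h"
    using ex_bij_betw_strict_mono_card[OF fin] A by blast
  \<comment> \<open>The enumeration \<open>h\<close> starts at 0, whereas tuples are indexed from
    1.\<close>
  have "A = (\<lambda>j. h (j - 1)) ` {1..u}"
  proof -
    have "{..<u} = (\<lambda>j. j - 1) ` {1..u}"
      by (force simp: image_iff intro: bexI[of _ "Suc _"])
    then show ?thesis
      using h(1) by (simp add: bij_betw_def image_image)
  qed
  moreover have "strict_mono_on {1..u} (\<lambda>j. h (j - 1))"
    by (rule strict_mono_onI, rule strict_mono_onD[OF h(2)]) auto
  ultimately show "\<exists>i \<in> {i. i \<in> {1..u} \<rightarrow>\<^sub>E {1..n} \<and> strict_mono_on {1..u} i}. A = i ` {1..u}"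
    using A by (intro bexI[of _ "\<lambda>j\<in>{1..u}. h (j - 1)"]) (auto simp: strict_mono_on_def)
qed

text \<open>Two injective enumerations of the same index set differ by the permutation
  \<open>\<pi>\<close>, the inverse of \<open>f\<close> after \<open>g\<close>, which symmetry
  absorbs.\<close>

lemma symmetric_kernel_eq:
  assumes sym: "symmetric_kernel u \<Psi>"
    and f: "inj_on f {1..u}" and g: "inj_on g {1..u}" and eq: "f ` {1..u} = g ` {1..u}"
  shows "\<Psi> (\<lambda>j\<in>{1..u}. x (f j)) = \<Psi> (\<lambda>j\<in>{1..u}. x (g j))"
proof -
  define \<pi> where "\<pi> = (\<lambda>j. if j \<in> {1..u} then the_inv_into {1..u} f (g j) else j)"
  have "bij_betw (the_inv_into {1..u} f \<circ> g) {1..u} {1..u}"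
    using f g eq by (intro bij_betw_trans[of g _ "g ` {1..u}"] bij_betw_imageI bij_betw_the_inv_into)
      (auto simp: bij_betw_def)
  then have "bij_betw \<pi> {1..u} {1..u}"
    by (rule bij_betw_cong[THEN iffD1, rotated]) (simp add: \<pi>_def)
  then have perm: "\<pi> permutes {1..u}"
    by (rule bij_imp_permutes) (simp add: \<pi>_def del: atLeastAtMost_iff)
  have fpi: "f (\<pi> j) = g j" if "j \<in> {1..u}" for j
    using that f eq by (simp add: \<pi>_def f_the_inv_into_f)
  have "\<Psi> (\<lambda>j\<in>{1..u}. (\<lambda>j\<in>{1..u}. x (f j)) (\<pi> j)) = \<Psi> (\<lambda>j\<in>{1..u}. x (f j))"
    by (rule sym[unfolded symmetric_kernel_def, rule_format, OF perm]) (simp add: restrict_PiE_iff del: restrict_apply)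
  also have "(\<lambda>j\<in>{1..u}. (\<lambda>j\<in>{1..u}. x (f j)) (\<pi> j)) = (\<lambda>j\<in>{1..u}. x (g j))"
    using permutes_in_image[OF perm] fpi by (intro restrict_ext) simp
  finally show ?thesis ..
qed

text \<open>The complements in \<open>S\<close> are equinumerous as well, so a bijection from
  \<open>A\<close> to \<open>B\<close> and one between the complements glue together.\<close>

lemma ex_permutes_image_eq:
  assumes S: "finite S" and A: "A \<subseteq> S" and B: "B \<subseteq> S" and card: "card A = card B"
  obtains p where "p permutes S" "p ` A = B"
proof -
  have fin: "finite A" "finite B" "finite (S - A)" "finite (S - B)"
    using S A B by (auto intro: finite_subset)
  obtain f where f: "bij_betw f A B"
    using fin card by (metis finite_same_card_bij)
  have "card (S - A) = card (S - B)"
    using A B fin card by (simp add: card_Diff_subset)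
  then obtain g where g: "bij_betw g (S - A) (S - B)"
    using fin by (metis finite_same_card_bij)
  define p where "p = (\<lambda>x. if x \<in> A then f x else if x \<in> S then g x else x)"
  have pf: "bij_betw p A B"
    using f by (rule bij_betw_cong[THEN iffD1, rotated]) (simp add: p_def)
  have "bij_betw p (S - A) (S - B)"
    using g by (rule bij_betw_cong[THEN iffD1, rotated]) (simp add: p_def)
  with pf have "bij_betw p (A \<union> (S - A)) (B \<union> (S - B))"
    by (rule bij_betw_combine) auto
  then have "bij_betw p S S"
    using A B by (simp add: Un_absorb1)
  then have "p permutes S"
    by (rule bij_imp_permutes) (use A in \<open>auto simp: p_def\<close>)
  then show thesis
    using pf that by (auto simp: bij_betw_def)
qed

text \<open>Composition with a permutation taking \<open>J\<close> to \<open>A\<close> shows that all images of \<open>J\<close> are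
  hit equally often, so the common multiplicity need not be computed.\<close>

lemma average_permutations_image:
  fixes F :: "'a set \<Rightarrow> 'b::real_vector"
  assumes S: "finite S" and J: "J \<subseteq> S"
  shows "(1 / fact (card S)) *\<^sub>R (\<Sum>p | p permutes S. F (p ` J))
    = (1 / real (card S choose card J)) *\<^sub>R (\<Sum>A | A \<subseteq> S \<and> card A = card J. F A)"
proof -
  define P where "P = {p. p permutes S}"
  define T where "T = {A. A \<subseteq> S \<and> card A = card J}"
  define N where "N = card {p \<in> P. p ` J = J}"
  have finP: "finite P" and finT: "finite T"
    using S by (auto simp: P_def T_def finite_permutations)
  have img: "(\<lambda>p. p ` J) ` P \<subseteq> T"
  proof safe
    fix p assume "p \<in> P"
    then have p: "p permutes S" by (simp add: P_def)
    then show "p ` J \<in> T"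
      using J permutes_image[OF p] by (auto simp: T_def card_image permutes_inj_on)
  qed
  have N: "card {p \<in> P. p ` J = A} = N" if A: "A \<in> T" for A
  proof -
    obtain q where q: "q permutes S" "q ` J = A"
      using ex_permutes_image_eq[OF S J, of A] A by (auto simp: T_def)
    have "bij_betw (\<lambda>p. q \<circ> p) {p \<in> P. p ` J = J} {p \<in> P. p ` J = A}"
    proof (rule bij_betw_byWitness[where f'="\<lambda>p. inv q \<circ> p"])
      show "\<forall>p\<in>{p \<in> P. p ` J = J}. inv q \<circ> (q \<circ> p) = p"
        using permutes_inv_o[OF q(1)] by (simp flip: comp_assoc)
      show "\<forall>p\<in>{p \<in> P. p ` J = A}. q \<circ> (inv q \<circ> p) = p"
        using permutes_inv_o[OF q(1)] by (simp flip: comp_assoc)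
      show "(\<lambda>p. q \<circ> p) ` {p \<in> P. p ` J = J} \<subseteq> {p \<in> P. p ` J = A}"
      proof (rule image_subsetI)
        fix p assume "p \<in> {p \<in> P. p ` J = J}"
        then have p: "p permutes S" "p ` J = J"
          by (auto simp: P_def)
        have "(q \<circ> p) ` J = A"
          using p(2) q(2) by (simp only: image_comp[symmetric])
        then show "q \<circ> p \<in> {p \<in> P. p ` J = A}"
          using permutes_compose[OF p(1)] q(1) by (simp add: P_def)
      qed
      have inv_q: "inv q ` A = J"
        unfolding q(2)[symmetric] using permutes_inj[OF q(1)] by (rule image_inv_f_f)
      show "(\<lambda>p. inv q \<circ> p) ` {p \<in> P. p ` J = A} \<subseteq> {p \<in> P. p ` J = J}"
      proof (rule image_subsetI)
        fix p assume "p \<in> {p \<in> P. p ` J = A}"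
        then have p: "p permutes S" "p ` J = A"
          by (auto simp: P_def)
        have "(inv q \<circ> p) ` J = J"
          using p(2) inv_q by (simp only: image_comp[symmetric])
        then show "inv q \<circ> p \<in> {p \<in> P. p ` J = J}"
          using permutes_compose[OF p(1)] permutes_inv[OF q(1)] by (simp add: P_def)
      qed
    qed
    then show ?thesis
      unfolding N_def by (simp add: bij_betw_same_card)
  qed
  have sum: "(\<Sum>p\<in>P. G (p ` J)) = real N *\<^sub>R (\<Sum>A\<in>T. G A)" for G :: "'a set \<Rightarrow> 'b::real_vector"
  proof -
    have "(\<Sum>p\<in>P. G (p ` J)) = (\<Sum>A\<in>T. \<Sum>p | p \<in> P \<and> p ` J = A. G (p ` J))"
      using finP finT img by (rule sum.group[symmetric])
    also have "\<dots> = (\<Sum>A\<in>T. real N *\<^sub>R G A)"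
      by (intro sum.cong refl) (simp add: N[symmetric] scaleR_conv_of_real sum_constant_scaleR)
    finally show ?thesis
      by (simp add: scaleR_sum_right)
  qed
  have cardT: "card T = card S choose card J"
    using n_subsets[OF S] by (simp add: T_def)
  \<comment> \<open>Counting all permutations by their image of \<open>J\<close> shows that N times
    the binomial coefficient is a factorial, which eliminates N.\<close>
  have "card P = (\<Sum>A\<in>T. card {p \<in> P. p ` J = A})"
    using sum.group[OF finP finT img, of "\<lambda>_. 1::nat"] by simp
  also have "\<dots> = card T * N"
    by (simp add: N)
  finally have "real (card P) = real N * real (card T)"
    by simp
  then have "fact (card S) = real N * real (card S choose card J)"
    using card_permutations[OF refl S] by (simp add: cardT P_def)
  moreover from this have "real N * real (card S choose card J) \<noteq> 0"
    by (metis fact_nonzero)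
  ultimately show ?thesis
    using sum[of F] by (simp add: P_def T_def)
qed

text \<open>Hoeffding's representation. The positions \<open>b\<close> are arbitrary, so every block
  yields the same average; the theorem exploits this by averaging over several disjoint
  blocks.\<close>

lemma U_statistic_eq_permutation_average:
  fixes \<Psi> :: "(nat \<Rightarrow> 'a) \<Rightarrow> 'h::real_vector"
  assumes sym: "symmetric_kernel u \<Psi>"
    and b: "inj_on b {1..u}" "b ` {1..u} \<subseteq> {1..n}"
  shows "U_statistic n u \<Psi> x
    = (1 / fact n) *\<^sub>R (\<Sum>p | p permutes {1..n}. \<Psi> (\<lambda>j\<in>{1..u}. x (p (b j))))"
proof -
  define E where "E = {i. i \<in> {1..u} \<rightarrow>\<^sub>E {1..n} \<and> strict_mono_on {1..u} i}"
  \<comment> \<open>\<open>e A\<close> is the increasing enumeration of \<open>A\<close>, so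
    \<open>F\<close> is the kernel viewed as a function of index sets.\<close>
  define e where "e = the_inv_into E (\<lambda>i. i ` {1..u})"
  define F where "F = (\<lambda>A. \<Psi> (\<lambda>j\<in>{1..u}. x (e A j)))"
  note bij = bij_betw_increasing_subsets[of u n, folded E_def]
  have inv: "e (i ` {1..u}) = i" if "i \<in> E" for i
    unfolding e_def using bij that by (intro the_inv_into_f_f) (auto simp: bij_betw_def)
  have e: "e A \<in> E" "e A ` {1..u} = A" if "A \<subseteq> {1..n}" "card A = u" for A
  proof -
    have "A \<in> (\<lambda>i. i ` {1..u}) ` E"
      unfolding bij_betw_imp_surj_on[OF bij] using that by simp
    then obtain i where i: "i \<in> E" "A = i ` {1..u}"
      by (elim imageE)
    then show "e A \<in> E" "e A ` {1..u} = A"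
      using inv[OF i(1)] i by simp_all
  qed
  have card_b: "card (b ` {1..u}) = u"
    using b by (simp add: card_image)
  have F: "\<Psi> (\<lambda>j\<in>{1..u}. x (p (b j))) = F (p ` b ` {1..u})" if p: "p permutes {1..n}" for p
  proof -
    have "p ` b ` {1..u} \<subseteq> {1..n}" "card (p ` b ` {1..u}) = u"
      using b permutes_image[OF p] by (auto simp: card_image permutes_inj_on[OF p] card_b)
    note e' = e[OF this]
    have "inj_on (p \<circ> b) {1..u}"
      using b permutes_inj_on[OF p] by (intro comp_inj_on)
    moreover have "inj_on (e (p ` b ` {1..u})) {1..u}"
      using e'(1) by (auto simp: E_def intro: strict_mono_on_imp_inj_on)
    ultimately show ?thesis
      unfolding F_def using symmetric_kernel_eq[OF sym, of "p \<circ> b" "e (p ` b ` {1..u})" x] e'(2)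
      by (simp add: image_comp)
  qed
  have "U_statistic n u \<Psi> x = (1 / real (n choose u)) *\<^sub>R (\<Sum>i\<in>E. F (i ` {1..u}))"
    unfolding U_statistic_def E_def[symmetric] F_def
    by (intro arg_cong[of _ _ "scaleR _"] sum.cong refl) (simp only: inv)
  also have "(\<Sum>i\<in>E. F (i ` {1..u})) = (\<Sum>A | A \<subseteq> {1..n} \<and> card A = u. F A)"
    by (rule sum.reindex_bij_betw[OF bij])
  also have "(1 / real (n choose u)) *\<^sub>R \<dots>
      = (1 / fact n) *\<^sub>R (\<Sum>p | p permutes {1..n}. F (p ` b ` {1..u}))"
    using average_permutations_image[of "{1..n}" "b ` {1..u}" F] b unfolding card_b by simp
  also have "\<dots> = (1 / fact n) *\<^sub>R (\<Sum>p | p permutes {1..n}. \<Psi> (\<lambda>j\<in>{1..u}. x (p (b j))))"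
    using F by simp
  finally show ?thesis .
qed

subsection \<open>The tail bound\<close>

theorem proposition13:
  fixes M :: "'w measure"
    and z :: "nat \<Rightarrow> 'w \<Rightarrow> real ^ 'p"
    and \<Psi> :: "(nat \<Rightarrow> real ^ 'p) \<Rightarrow> 'h::{real_inner, complete_space}"
    and n u :: nat and c C :: real
  assumes "prob_space M"
    and "1 \<le> u" and "u \<le> n"
    and indep: "prob_space.indep_vars M (\<lambda>_. borel) z {1..n}"
    and ident: "\<And>i j. i \<in> {1..n} \<Longrightarrow> j \<in> {1..n} \<Longrightarrow> distr M borel (z i) = distr M borel (z j)"
    and meas: "strongly_measurable (Pi\<^sub>M {1..u} (\<lambda>_. borel)) \<Psi>"
    and sym: "symmetric_kernel u \<Psi>"
    and mean: "has_strong_integral M (\<lambda>\<omega>. \<Psi> (\<lambda>j\<in>{1..u}. z j \<omega>)) 0"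
    and "0 < C"
    and bound: "AE \<omega> in M. norm (\<Psi> (\<lambda>j\<in>{1..u}. z j \<omega>)) \<le> C"
    and "0 < c"
  shows "measure M {\<omega> \<in> space M. norm (U_statistic n u \<Psi> (\<lambda>i. z i \<omega>)) \<ge> c}
           \<le> 2 * exp (- (of_int \<lfloor>real n / real u\<rfloor> * c\<^sup>2 / (4 * C\<^sup>2)))"
proof -
  interpret prob_space M by fact
  define k where "k = n div u"
  \<comment> \<open>This value minimises the final exponent t^2 C^2 / (2k) - t c.\<close>
  define t where "t = real k * c / C\<^sup>2"
  define D where "D = distr M borel (z 1)"
  define Q where "Q = Pi\<^sub>M {1..u} (\<lambda>_. D)"
  define g where "g y = (t / real k) *\<^sub>R \<Psi> y" for y
  \<comment> \<open>Block \<open>l\<close>, counted from 0, occupies positions l u + 1 to l u + u;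
    the blocks with l < k are disjoint and fit into \<open>{1..n}\<close>.\<close>
  define b where "b l j = l * u + j" for l j :: nat
  define S where "S p \<omega> = (\<Sum>l<k. g (\<lambda>j\<in>{1..u}. z (p (b l j)) \<omega>))" for p \<omega>
  define P where "P = {p. p permutes {1..n}}"
  define U where "U \<omega> = U_statistic n u \<Psi> (\<lambda>i. z i \<omega>)" for \<omega>
  define A where "A = {\<omega> \<in> space M. norm (U \<omega>) \<ge> c}"
  have k: "0 < k" and ku: "k * u \<le> n"
    using \<open>1 \<le> u\<close> \<open>u \<le> n\<close> by (auto simp: k_def div_greater_zero_iff)
  have t: "0 < t"
    using k \<open>0 < c\<close> \<open>0 < C\<close> by (simp add: t_def)
  have rv: "z i \<in> measurable M borel" if "i \<in> {1..n}" for i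
    using indep that by (auto simp: indep_vars_def2)
  have D: "distr M borel (z i) = D" if "i \<in> {1..n}" for i
    using ident[OF that, of 1] \<open>1 \<le> u\<close> \<open>u \<le> n\<close> by (simp add: D_def)
  have sets_D: "sets D = sets borel"
    by (simp add: D_def)
  have sets_Q: "sets Q = sets (Pi\<^sub>M {1..u} (\<lambda>_. borel))"
    unfolding Q_def by (intro sets_PiM_cong sets_D refl)
  \<comment> \<open>\<open>Q\<close> is the law of one argument tuple; the almost sure bound and the
    mean are transported to it below.\<close>
  have tuple: "distr M (Pi\<^sub>M {1..u} (\<lambda>_. borel)) (\<lambda>\<omega>. \<lambda>j\<in>{1..u}. z j \<omega>) = Q"
    unfolding Q_def using \<open>1 \<le> u\<close> \<open>u \<le> n\<close>
    by (intro distr_iid_tuple[OF indep D, of "\<lambda>j. j"]) auto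
  have tuple_meas: "(\<lambda>\<omega>. \<lambda>j\<in>{1..u}. z j \<omega>) \<in> measurable M (Pi\<^sub>M {1..u} (\<lambda>_. borel))"
    using \<open>u \<le> n\<close> by (intro measurable_restrict rv) auto
  have Q: "prob_space Q"
    unfolding tuple[symmetric] by (rule prob_space_distr[OF tuple_meas])
  have g_meas: "strongly_measurable (Pi\<^sub>M {1..u} (\<lambda>_. borel)) g"
    unfolding g_def by (rule strongly_measurable_continuous[OF _ meas]) (intro continuous_intros)
  have g_meas_Q: "strongly_measurable Q g"
    by (rule strongly_measurable_compose[OF measurable_ident_sets[OF sets_Q] g_meas])
  have g_bound: "AE y in Q. norm (g y) \<le> t * C / real k"
  proof -
    have "AE \<omega> in M. norm (g (\<lambda>j\<in>{1..u}. z j \<omega>)) \<le> t * C / real k"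
      using bound by eventually_elim (use t k in \<open>simp add: g_def divide_right_mono\<close>)
    moreover have "(\<lambda>y. norm (g y)) \<in> borel_measurable (Pi\<^sub>M {1..u} (\<lambda>_. borel))"
      by (rule borel_measurable_strongly_measurable_continuous[OF _ g_meas]) (intro continuous_intros)
    ultimately show ?thesis
      unfolding tuple[symmetric] by (subst AE_distr_iff[OF tuple_meas]) auto
  qed
  have g_mean: "has_bochner_integral Q (\<lambda>y. inner w (g y)) 0" for w
  proof -
    have "has_bochner_integral M (\<lambda>\<omega>. inner ((t / real k) *\<^sub>R w) (\<Psi> (\<lambda>j\<in>{1..u}. z j \<omega>))) 0"
      using has_strong_integral_inner[OF mean, of "(t / real k) *\<^sub>R w"] by simp
    then have "has_bochner_integral M (\<lambda>\<omega>. inner w (g (\<lambda>j\<in>{1..u}. z j \<omega>))) 0"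
      by (simp add: g_def)
    moreover have "(\<lambda>y. inner w (g y)) \<in> borel_measurable (Pi\<^sub>M {1..u} (\<lambda>_. borel))"
      by (rule borel_measurable_strongly_measurable_continuous[OF _ g_meas]) (intro continuous_intros)
    ultimately show ?thesis
      unfolding tuple[symmetric]
      by (simp only: has_bochner_integral_iff integrable_distr_eq[OF tuple_meas]
          integral_distr[OF tuple_meas])
  qed
  have b_range: "b l j \<in> {1..n}" if "l < k" "j \<in> {1..u}" for l j
  proof -
    have "b l j \<le> Suc l * u"
      using that by (simp add: b_def)
    also have "\<dots> \<le> k * u"
      using that by (intro mult_right_mono) auto
    finally show ?thesis
      using ku that by (simp add: b_def)
  qed
  have b_inj: "inj_on (\<lambda>(l, j). b l j) ({..<k} \<times> {1..u})"
  proof (rule inj_onI, clarify)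
    fix l j l' j' assume j: "j \<in> {1..u}" "j' \<in> {1..u}" and eq: "b l j = b l' j'"
    \<comment> \<open>After subtracting 1, the offset j - 1 is a genuine remainder below u, so
      division recovers block and offset.\<close>
    have *: "(b l j - 1) div u = l \<and> (b l j - 1) mod u = j - 1" if "j \<in> {1..u}" for l j
    proof -
      have "b l j - 1 = (j - 1) + l * u" "j - 1 < u"
        using that by (auto simp: b_def)
      then show ?thesis by simp
    qed
    have "l = l'" "j - 1 = j' - 1"
      using *[OF j(1), of l] *[OF j(2), of l'] eq by auto
    then show "l = l' \<and> j = j'"
      using j by auto
  qed
  have block_inj: "inj_on (b l) {1..u}" for l
    by (simp add: b_def inj_on_def)
  have S_meas: "strongly_measurable M (S p)" if p: "p permutes {1..n}" for p
    unfolding S_def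
  proof (intro strongly_measurable_sum strongly_measurable_compose[OF _ g_meas] measurable_restrict rv)
    show "p (b l j) \<in> {1..n}" if "l \<in> {..<k}" "j \<in> {1..u}" for l j
      using b_range that permutes_in_image[OF p] by simp
  qed simp
  have S_int: "(\<integral>\<^sup>+\<omega>. cosh (norm (S p \<omega>)) \<partial>M) \<le> ennreal (exp (t\<^sup>2 * C\<^sup>2 / (2 * real k)))"
    if p: "p permutes {1..n}" for p
  proof -
    let ?B = "\<lambda>\<omega>. \<lambda>l\<in>{..<k}. \<lambda>j\<in>{1..u}. z (p (b l j)) \<omega>"
    let ?N = "Pi\<^sub>M {..<k} (\<lambda>_. Pi\<^sub>M {1..u} (\<lambda>_. borel))"
    have in_range: "p (b l j) \<in> {1..n}" if "l < k" "j \<in> {1..u}" for l j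
      using b_range[OF that] permutes_in_image[OF p] by simp
    \<comment> \<open>A permutation keeps the blocks disjoint, so for every \<open>p\<close> they
      form k independent tuples with law \<open>Q\<close>.\<close>
    have "inj_on (p \<circ> (\<lambda>(l, j). b l j)) ({..<k} \<times> {1..u})"
      by (intro comp_inj_on b_inj permutes_inj_on[OF p])
    then have distr: "distr M ?N ?B = Pi\<^sub>M {..<k} (\<lambda>_. Q)"
      unfolding Q_def using k \<open>1 \<le> u\<close> in_range
      by (intro distr_iid_blocks[OF indep D]) (auto simp: comp_def case_prod_unfold)
    have B: "?B \<in> measurable M ?N"
      using in_range by (intro measurable_restrict rv) auto
    have "strongly_measurable ?N (\<lambda>x. \<Sum>l<k. g (x l))"
      by (intro strongly_measurable_sum strongly_measurable_compose[OF _ g_meas]) auto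
    then have sum_meas: "(\<lambda>x. ennreal (cosh (norm (\<Sum>l<k. g (x l))))) \<in> borel_measurable ?N"
      by (intro measurable_compose[OF _ measurable_ennreal]
          borel_measurable_strongly_measurable_continuous[of "\<lambda>v. cosh (norm v)"])
        (auto intro!: continuous_intros)
    have "(\<integral>\<^sup>+\<omega>. cosh (norm (S p \<omega>)) \<partial>M)
        = (\<integral>\<^sup>+\<omega>. cosh (norm (\<Sum>l<k. g (?B \<omega> l))) \<partial>M)"
      by (simp add: S_def)
    also have "\<dots> = (\<integral>\<^sup>+x. cosh (norm (\<Sum>l<k. g (x l))) \<partial>Pi\<^sub>M {..<k} (\<lambda>_. Q))"
      unfolding distr[symmetric] by (rule nn_integral_distr[OF B, symmetric]) (use sum_meas in simp)
    also have "\<dots> \<le> ennreal (exp ((t * C / real k)\<^sup>2 / 2) ^ card {..<k})"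
      using t k \<open>0 < C\<close> by (intro nn_integral_cosh_norm_sum_le[OF Q _ g_meas_Q g_bound g_mean]) auto
    \<comment> \<open>The k exponents (tC/k)^2 / 2 add up to t^2 C^2 / (2k).\<close>
    also have "exp ((t * C / real k)\<^sup>2 / 2) ^ card {..<k} = exp (t\<^sup>2 * C\<^sup>2 / (2 * real k))"
      using k by (simp add: power2_eq_square field_simps flip: exp_of_nat_mult)
    finally show ?thesis .
  qed
  have finP: "finite P" and cardP: "card P = fact n"
    by (simp_all add: P_def finite_permutations card_permutations)
  \<comment> \<open>Each of the k blocks represents the same U, so k copies weighted by t/k give t
    U; exchanging the sums collects the blocks under each permutation.\<close>
  have U_eq: "t *\<^sub>R U \<omega> = (1 / fact n) *\<^sub>R (\<Sum>p\<in>P. S p \<omega>)" for \<omega>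
  proof -
    have "U \<omega> = (1 / fact n) *\<^sub>R (\<Sum>p\<in>P. \<Psi> (\<lambda>j\<in>{1..u}. z (p (b l j)) \<omega>))" if "l < k" for l
      unfolding U_def P_def using b_range[OF that]
      by (intro U_statistic_eq_permutation_average[OF sym block_inj]) auto
    then have "(\<Sum>l<k. (t / real k) *\<^sub>R U \<omega>)
        = (\<Sum>l<k. (t / real k) *\<^sub>R (1 / fact n) *\<^sub>R (\<Sum>p\<in>P. \<Psi> (\<lambda>j\<in>{1..u}. z (p (b l j)) \<omega>)))"
      by (intro sum.cong) auto
    also have "\<dots> = (1 / fact n) *\<^sub>R (\<Sum>l<k. \<Sum>p\<in>P. g (\<lambda>j\<in>{1..u}. z (p (b l j)) \<omega>))"
      by (simp add: g_def scaleR_sum_right mult.commute)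
    also have "(\<Sum>l<k. \<Sum>p\<in>P. g (\<lambda>j\<in>{1..u}. z (p (b l j)) \<omega>)) = (\<Sum>p\<in>P. S p \<omega>)"
      unfolding S_def by (rule sum.swap)
    finally show ?thesis
      using k by (simp add: sum_constant_scaleR)
  qed
  \<comment> \<open>The triangle inequality, monotonicity of cosh on nonnegative reals, and Jensen
    with weight 1/n! on each of the n! permutations.\<close>
  have cosh_U: "cosh (t * norm (U \<omega>)) \<le> (\<Sum>p\<in>P. 1 / fact n * cosh (norm (S p \<omega>)))" for \<omega>
  proof -
    have "t * norm (U \<omega>) = norm (t *\<^sub>R U \<omega>)"
      using t by simp
    also have "\<dots> \<le> (\<Sum>p\<in>P. (1 / fact n) *\<^sub>R norm (S p \<omega>))"
      unfolding U_eq by (simp add: divide_right_mono norm_sum flip: sum_divide_distrib)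
    finally have "cosh (t * norm (U \<omega>)) \<le> cosh (\<Sum>p\<in>P. (1 / fact n) *\<^sub>R norm (S p \<omega>))"
      using t by (subst cosh_real_nonneg_le_iff) (auto intro: sum_nonneg)
    also have "\<dots> \<le> (\<Sum>p\<in>P. 1 / fact n * cosh (norm (S p \<omega>)))"
      using finP cardP by (intro convex_on_sum[OF _ _ convex_on_cosh]) auto
    finally show ?thesis .
  qed
  have cosh_int: "(\<integral>\<^sup>+\<omega>. cosh (t * norm (U \<omega>)) \<partial>M) \<le> ennreal (exp (t\<^sup>2 * C\<^sup>2 / (2 * real k)))"
  proof -
    have S_meas': "(\<lambda>\<omega>. ennreal (cosh (norm (S p \<omega>)))) \<in> borel_measurable M" if "p \<in> P" for p
      using that S_meas
      by (intro measurable_compose[OF _ measurable_ennreal]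
          borel_measurable_strongly_measurable_continuous[of "\<lambda>v. cosh (norm v)"])
        (auto simp: P_def intro!: continuous_intros)
    have "(\<integral>\<^sup>+\<omega>. cosh (t * norm (U \<omega>)) \<partial>M)
        \<le> (\<integral>\<^sup>+\<omega>. (\<Sum>p\<in>P. ennreal (1 / fact n) * ennreal (cosh (norm (S p \<omega>)))) \<partial>M)"
      by (intro nn_integral_mono) (use cosh_U in \<open>simp add: ennreal_leI flip: ennreal_mult\<close>)
    also have "\<dots> = (\<Sum>p\<in>P. ennreal (1 / fact n) * (\<integral>\<^sup>+\<omega>. cosh (norm (S p \<omega>)) \<partial>M))"
      using S_meas' by (simp add: nn_integral_sum nn_integral_cmult)
    also have "\<dots> \<le> (\<Sum>p\<in>P. ennreal (1 / fact n) * ennreal (exp (t\<^sup>2 * C\<^sup>2 / (2 * real k))))"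
      using S_int by (intro sum_mono mult_left_mono) (auto simp: P_def)
    also have "\<dots> = ennreal (exp (t\<^sup>2 * C\<^sup>2 / (2 * real k)))"
      by (simp add: cardP ennreal_of_nat_eq_real_of_nat flip: ennreal_mult)
    finally show ?thesis .
  qed
  \<comment> \<open>Markov's inequality for cosh(t |U|). If \<open>A\<close> is not an event, its
    \<open>measure\<close> is 0 by convention, so the case distinction replaces a proof of its
    measurability.\<close>
  have "measure M A * cosh (t * c) \<le> exp (t\<^sup>2 * C\<^sup>2 / (2 * real k))"
  proof (cases "A \<in> events")
    case True
    have "ennreal (measure M A * cosh (t * c)) = (\<integral>\<^sup>+\<omega>. ennreal (cosh (t * c)) * indicator A \<omega> \<partial>M)"
      unfolding nn_integral_cmult_indicator[OF True]
      by (simp add: emeasure_eq_measure ennreal_mult mult.commute)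
    also have "\<dots> \<le> (\<integral>\<^sup>+\<omega>. cosh (t * norm (U \<omega>)) \<partial>M)"
      using t \<open>0 < c\<close> by (intro nn_integral_mono)
        (auto simp: A_def cosh_real_nonneg_le_iff split: split_indicator intro!: ennreal_leI)
    also have "\<dots> \<le> ennreal (exp (t\<^sup>2 * C\<^sup>2 / (2 * real k)))"
      by (rule cosh_int)
    finally show ?thesis
      by (simp add: ennreal_le_iff)
  next
    case False
    then show ?thesis
      by (simp add: measure_notin_sets)
  qed
  \<comment> \<open>This is the source of the factor 2 in the tail bound.\<close>
  moreover have "exp (t * c) / 2 \<le> cosh (t * c)"
    by (simp add: cosh_def)
  ultimately have "measure M A * (exp (t * c) / 2) \<le> exp (t\<^sup>2 * C\<^sup>2 / (2 * real k))"
    by (meson measure_nonneg mult_left_mono order_trans)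
  then have "measure M A \<le> 2 * exp (t\<^sup>2 * C\<^sup>2 / (2 * real k) - t * c)"
    by (simp add: exp_diff field_simps)
  also have "t\<^sup>2 * C\<^sup>2 / (2 * real k) - t * c = - (real k * c\<^sup>2 / (2 * C\<^sup>2))"
    using k \<open>0 < C\<close> by (simp add: t_def field_simps power2_eq_square)
  also have "2 * exp (- (real k * c\<^sup>2 / (2 * C\<^sup>2))) \<le> 2 * exp (- (real k * c\<^sup>2 / (4 * C\<^sup>2)))"
    using \<open>0 < C\<close> by (simp add: frac_le)
  \<comment> \<open>Natural-number division is the floor of the real quotient.\<close>
  also have "real k = of_int \<lfloor>real n / real u\<rfloor>"
    by (simp add: k_def floor_divide_of_nat_eq)
  finally show ?thesis
    by (simp add: A_def U_def)
qed

end
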